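(* There is an absolute constant $M>0$ such that for every $f\in C_B[0,\infty)$, every $n\in\mathbb{N}$, every $\alpha\in[0,\frac1n]$ and every $x\in[0,\infty)$, $$\left|\mathcal{U}_{n}^{[\alpha]}(f;x)-f(x)\right|\leq M\,\omega_2\big(f;\sqrt{\rho_n(x)}\big)+\omega\big(f;\nu_n(x)\big),$$ where $\nu_n(x)=\Theta_{n,1}^{[\alpha]}(x)$ and $\rho_n(x)=\Theta_{n,2}^{[\alpha]}(x)+\frac{1}{n^2}$.
   Context: For $n\in\mathbb{N}$, $0\le\alpha\le\frac1n$, $x\ge 0$ and a function $f$ on $[0,\infty)$ for which the expression converges absolutely, define $$\mathcal{U}_{n}^{[\alpha]}(f;x)=n\sum_{i=0}^{\infty}(1+n\alpha)^{-x/\alpha}\Big(\alpha+\frac1n\Big)^{-i}\frac{x^{(i,-\alpha)}}{i!}\int_0^\infty e^{-nu}\frac{(nu)^i}{i!}f(u)\,du,$$ with $x^{(0,-\alpha)}=1$ and $x^{(i,-\alpha)}=x(x+\alpha)\cdots(x+(i-1)\alpha)$; for $\alpha=0$ the coefficient is understood as its limit as $\alpha\to0$, namely $e^{-nx}\frac{(nx)^i}{i!}$. Central moments: $\Theta_{n,m}^{[\alpha]}(x)=\mathcal{U}_{n}^{[\alpha]}((t-x)^m;x)$, the operator acting on the variable $t$. $C_B[0,\infty)$ is the space of continuous bounded functions on $[0,\infty)$. For $f\in C_B[0,\infty)$ and $\xi>0$: $\omega(f;\xi)=\sup_{h\in[0,\xi],\,x\ge0}|f(x+h)-f(x)|$ and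 $\omega_2(f;\sqrt{\xi})=\sup_{h\in[0,\sqrt{\xi}],\,x\ge0}|f(x+2h)-2f(x+h)+f(x)|$. *)

theory Defs
  imports "HOL-Analysis.Analysis"
begin

text \<open>
  Functions on $[0,\infty)$ are modelled as functions of type \<^typ>\<open>real \<Rightarrow> real\<close>;
  nothing below inspects their values at negative arguments.
\<close>

definition rising :: "real \<Rightarrow> nat \<Rightarrow> real \<Rightarrow> real" where
  "rising x i \<alpha> = (\<Prod>k<i. x + real k * \<alpha>)"

definition weight :: "nat \<Rightarrow> real \<Rightarrow> nat \<Rightarrow> real \<Rightarrow> real" where
  "weight n \<alpha> i x =
     (if \<alpha> = 0 then exp (- (real n * x)) * (real n * x) ^ i / fact i
      else (1 + real n * \<alpha>) powr (- x / \<alpha>) * inverse ((\<alpha> + 1 / real n) ^ i)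
             * (rising x i \<alpha> / fact i))"

text \<open>The value at \<open>\<alpha> = 0\<close> is the continuous extension of the general formula.\<close>

lemma weight_tendsto:
  assumes "n \<ge> 1"
  shows "((\<lambda>\<alpha>. weight n \<alpha> i x) \<longlongrightarrow> weight n 0 i x) (at_right 0)"
proof -
  have e: "((\<lambda>\<alpha>. ((1 + real n * \<alpha>) powr (1 / \<alpha>)) powr (- x)) \<longlongrightarrow> exp (real n) powr (- x)) (at_right 0)"
    by (intro tendsto_powr tendsto_exp_limit_at_right tendsto_const) auto
  have r: "((\<lambda>\<alpha>. rising x i \<alpha>) \<longlongrightarrow> x ^ i) (at_right 0)"
  proof -
    have "((\<lambda>\<alpha>. rising x i \<alpha>) \<longlongrightarrow> (\<Prod>k<i. x + real k * 0)) (at_right 0)"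
      unfolding rising_def by (intro tendsto_intros)
    then show ?thesis by simp
  qed
  have q: "((\<lambda>\<alpha>. inverse ((\<alpha> + 1 / real n) ^ i)) \<longlongrightarrow> inverse ((0 + 1 / real n) ^ i)) (at_right 0)"
    using assms by (intro tendsto_intros) auto
  have "((\<lambda>\<alpha>. ((1 + real n * \<alpha>) powr (1 / \<alpha>)) powr (- x) * inverse ((\<alpha> + 1 / real n) ^ i)
           * (rising x i \<alpha> / fact i))
         \<longlongrightarrow> exp (real n) powr (- x) * inverse ((0 + 1 / real n) ^ i) * (x ^ i / fact i)) (at_right 0)"
    by (intro tendsto_mult e q tendsto_divide r tendsto_const) auto
  moreover have "exp (real n) powr (- x) * inverse ((0 + 1 / real n) ^ i) * (x ^ i / fact i) = weight n 0 i x"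
    by (simp add: weight_def powr_def power_mult_distrib power_divide mult_ac)
  moreover have "\<forall>\<^sub>F \<alpha> in at_right 0. ((1 + real n * \<alpha>) powr (1 / \<alpha>)) powr (- x)
       * inverse ((\<alpha> + 1 / real n) ^ i) * (rising x i \<alpha> / fact i) = weight n \<alpha> i x"
    using eventually_at_right_less[of "0::real"]
    by eventually_elim (simp add: weight_def powr_powr)
  ultimately show ?thesis
    using Lim_transform_eventually by fastforce
qed

definition U :: "nat \<Rightarrow> real \<Rightarrow> (real \<Rightarrow> real) \<Rightarrow> real \<Rightarrow> real" where
  "U n \<alpha> f x =
     real n * (\<Sum>i. weight n \<alpha> i x *
       (LINT u:{0..}|lborel. exp (- (real n * u)) * ((real n * u) ^ i / fact i) * f u))"

definition central_moment :: "nat \<Rightarrow> real \<Rightarrow> nat \<Rightarrow> real \<Rightarrow> real" where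
  "central_moment n \<alpha> m x = U n \<alpha> (\<lambda>t. (t - x) ^ m) x"

definition C_B :: "(real \<Rightarrow> real) set" where
  "C_B = {f. continuous_on {0..} f \<and> bounded (f ` {0..})}"

text \<open>
  The real-valued suprema below are only meaningful for bounded \<open>f\<close> and nonnegative \<open>\<xi>\<close>, \<open>\<delta>\<close>.
  The second modulus takes the step bound \<open>\<delta>\<close> itself, so $\omega_2(f;\sqrt\xi)$ is
  \<open>omega2 f (sqrt \<xi>)\<close>.
\<close>

definition omega :: "(real \<Rightarrow> real) \<Rightarrow> real \<Rightarrow> real" where
  "omega f \<xi> = (SUP (h, x) \<in> {0..\<xi>} \<times> {0..}. \<bar>f (x + h) - f x\<bar>)"

definition omega2 :: "(real \<Rightarrow> real) \<Rightarrow> real \<Rightarrow> real" where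
  "omega2 f \<delta> = (SUP (h, x) \<in> {0..\<delta>} \<times> {0..}. \<bar>f (x + 2 * h) - 2 * f (x + h) + f x\<bar>)"

definition nu :: "nat \<Rightarrow> real \<Rightarrow> real \<Rightarrow> real" where
  "nu n \<alpha> x = central_moment n \<alpha> 1 x"

definition rho :: "nat \<Rightarrow> real \<Rightarrow> real \<Rightarrow> real" where
  "rho n \<alpha> x = central_moment n \<alpha> 2 x + 1 / (real n)\<^sup>2"

end

theory Submission
  imports Defs "HOL-Probability.Distributions"
begin

text \<open>
  The operator is the expectation over a law on $[0,\infty)$ (a negative binomial, or Poisson,
  mixture of Erlang laws) with mean $m = x + \frac1n$ and variance at most $\delta^2 = \rho_n(x)$.
  Let $W = \omega_2(f;\delta)$ and let $c$ be the slope of the chord of $f$ over $[m, m+\delta]$.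
  Discrete integration of the second differences gives
  $|f(t) - f(m) - c(t-m)| \le W\,(9 + 4(t-m)^2/\delta^2)$ for all $t \ge 0$. Taking expectations
  kills the linear term, so $|U f(x) - f(m)| \le 13 W$, while $m - x = \nu_n(x)$ yields
  $|f(m) - f(x)| \le \omega(f;\nu_n(x))$. No smoothing of $f$ is needed.
\<close>

section \<open>Second differences and tangents\<close>

text \<open>A self-improving bound: boundedness makes the supremum \<open>S\<close> of
  \<open>\<bar>g\<bar>\<close> over the interval finite, so it can be cancelled from an estimate of
  \<open>S\<close> by \<open>(W + S) / 2\<close>.\<close>

lemma abs_le_of_second_difference:
  fixes g :: "real \<Rightarrow> real"
  assumes ends: "g p = 0" "g (p + \<delta>) = 0"
    and bdd: "bdd_above ((\<lambda>t. \<bar>g t\<bar>) ` {p..p + \<delta>})"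
    and W: "\<And>s h. s \<ge> p \<Longrightarrow> 0 \<le> h \<Longrightarrow> h \<le> \<delta> \<Longrightarrow> \<bar>g (s + 2 * h) - 2 * g (s + h) + g s\<bar> \<le> W"
    and t: "t \<in> {p..p + \<delta>}"
  shows "\<bar>g t\<bar> \<le> W"
proof -
  define S where "S = (SUP t\<in>{p..p + \<delta>}. \<bar>g t\<bar>)"
  have S: "\<bar>g u\<bar> \<le> S" if "u \<in> {p..p + \<delta>}" for u
    unfolding S_def by (rule cSUP_upper[OF that bdd])
  \<comment> \<open>Reflect the nearer endpoint, where \<open>g\<close> vanishes, in \<open>u\<close>; this forces \<open>S \<le> (W + S) / 2\<close>.\<close>
  have half: "\<bar>g u\<bar> \<le> (W + S) / 2" if u: "u \<in> {p..p + \<delta>}" for u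
  proof (cases "u \<le> p + \<delta> / 2")
    case True
    have "\<bar>g (p + 2 * (u - p)) - 2 * g (p + (u - p)) + g p\<bar> \<le> W"
      using u True by (intro W) auto
    moreover have "\<bar>g (p + 2 * (u - p))\<bar> \<le> S"
      using u True by (intro S) auto
    ultimately show ?thesis using ends by (simp add: algebra_simps abs_le_iff) linarith
  next
    case False
    let ?h = "p + \<delta> - u" and ?s = "2 * u - p - \<delta>"
    have "\<bar>g (?s + 2 * ?h) - 2 * g (?s + ?h) + g ?s\<bar> \<le> W"
      using u False by (intro W) auto
    moreover have "?s + 2 * ?h = p + \<delta>" "?s + ?h = u" by simp_all
    moreover have "\<bar>g ?s\<bar> \<le> S"
      using u False by (intro S) auto
    ultimately show ?thesis using ends by (simp add: algebra_simps abs_le_iff) linarith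
  qed
  have "S \<le> (W + S) / 2"
    unfolding S_def using t half by (intro cSUP_least) (auto simp: S_def)
  then show ?thesis using S[OF t] by simp
qed

text \<open>Summing twice: the first differences of \<open>b\<close> start below
  \<open>4 * W\<close> and grow by at most \<open>W\<close> per step, so their sum is quadratic in
  \<open>k\<close>. The second differences are controlled only up to \<open>k\<close> because a
  progression descending inside the half-line may leave it after its last term.\<close>

lemma second_difference_growth:
  fixes b :: "nat \<Rightarrow> real"
  assumes "\<bar>b 0\<bar> \<le> W" "\<bar>b 1\<bar> \<le> 3 * W"
    and "\<And>j. j + 2 \<le> k \<Longrightarrow> \<bar>b (j + 2) - 2 * b (j + 1) + b j\<bar> \<le> W"
  shows "\<bar>b k\<bar> \<le> W * (1 + 4 * real k + (real k)\<^sup>2)"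
proof -
  have W0: "0 \<le> W" using assms(1) by simp
  have d: "\<bar>b (Suc i) - b i\<bar> \<le> W * (4 + real i)" if "Suc i \<le> k" for i
    using that
  proof (induction i)
    case 0
    then show ?case using assms(1,2) by simp
  next
    case (Suc i)
    then have "\<bar>b (Suc i) - b i\<bar> \<le> W * (4 + real i)" by simp
    moreover have "\<bar>b (i + 2) - 2 * b (i + 1) + b i\<bar> \<le> W" using Suc.prems by (intro assms(3)) simp
    ultimately show ?case by (simp add: abs_le_iff algebra_simps)
  qed
  have "\<bar>b i\<bar> \<le> W * (1 + 4 * real i + (real i)\<^sup>2)" if "i \<le> k" for i
    using that
  proof (induction i)
    case 0
    then show ?case using assms(1) by simp
  next
    case (Suc i)
    have "\<bar>b (Suc i)\<bar> \<le> W * (1 + 4 * real i + (real i)\<^sup>2) + W * (4 + real i)"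
      using Suc d[of i] by simp
    also have "\<dots> = W * (5 + 5 * real i + (real i)\<^sup>2)" by (simp add: algebra_simps)
    also have "\<dots> \<le> W * (1 + 4 * real (Suc i) + (real (Suc i))\<^sup>2)"
      using W0 by (intro mult_left_mono) (auto simp: power2_eq_square algebra_simps)
    finally show ?case .
  qed
  then show ?thesis by simp
qed

text \<open>Subtracting the chord keeps the second differences and makes \<open>g\<close> vanish at
  \<open>m\<close> and \<open>m + \<delta>\<close>. Hence \<open>\<bar>g\<bar>\<close> is at most
  \<open>W\<close> between these zeros and at most \<open>3 * W\<close> on the adjacent intervals; a
  walk with step \<open>\<delta>\<close> from the chord interval to \<open>t\<close> then gives
  quadratic growth.\<close>

lemma second_difference_tangent:
  fixes f :: "real \<Rightarrow> real"
  assumes \<delta>: "\<delta> > 0" and m: "m \<ge> 0" and f: "bounded (f ` {0..})"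
    and W: "\<And>s h. s \<ge> 0 \<Longrightarrow> 0 \<le> h \<Longrightarrow> h \<le> \<delta> \<Longrightarrow> \<bar>f (s + 2 * h) - 2 * f (s + h) + f s\<bar> \<le> W"
    and t: "t \<ge> 0"
  shows "\<bar>f t - f m - (f (m + \<delta>) - f m) / \<delta> * (t - m)\<bar> \<le> W * (9 + 4 * ((t - m) / \<delta>)\<^sup>2)"
proof -
  define c where "c = (f (m + \<delta>) - f m) / \<delta>"
  define g where "g = (\<lambda>t. f t - f m - c * (t - m))"
  have gW: "\<bar>g (s + 2 * h) - 2 * g (s + h) + g s\<bar> \<le> W" if "s \<ge> 0" "0 \<le> h" "h \<le> \<delta>" for s h
    using W[OF that] by (simp add: g_def algebra_simps)
  have W0: "0 \<le> W" using W[of 0 0] \<delta> by simp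
  obtain B where B: "\<And>u. u \<ge> 0 \<Longrightarrow> \<bar>f u\<bar> \<le> B"
    using f by (auto simp: bounded_iff)
  have ends: "g m = 0" "g (m + \<delta>) = 0" using \<delta> by (simp_all add: g_def c_def)
  have "bdd_above ((\<lambda>t. \<bar>g t\<bar>) ` {m..m + \<delta>})"
  proof (rule bdd_aboveI2)
    fix u assume u: "u \<in> {m..m + \<delta>}"
    have "\<bar>c * (u - m)\<bar> \<le> \<bar>c\<bar> * \<delta>" using u \<delta> by (auto simp: abs_mult intro!: mult_left_mono)
    then show "\<bar>g u\<bar> \<le> 2 * B + \<bar>c\<bar> * \<delta>"
      using B[of u] B[of m] u m by (auto simp: g_def)
  qed
  then have near: "\<bar>g u\<bar> \<le> W" if "u \<in> {m..m + \<delta>}" for u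
    using abs_le_of_second_difference[OF ends _ _ that] gW m by simp
  \<comment> \<open>The midpoint of \<open>m\<close> and \<open>u\<close> lies in the chord interval
    and \<open>g m = 0\<close>, so the bound is \<open>W + 2 * W\<close>. It serves as the second
    starting value for the growth lemma.\<close>
  have right: "\<bar>g u\<bar> \<le> 3 * W" if u: "u \<in> {m + \<delta>..m + 2 * \<delta>}" for u
  proof -
    let ?h = "(u - m) / 2"
    have "\<bar>g (m + 2 * ?h) - 2 * g (m + ?h) + g m\<bar> \<le> W" using u m \<delta> by (intro gW) auto
    moreover have "m + 2 * ?h = u" by (simp add: field_simps)
    moreover have "\<bar>g (m + ?h)\<bar> \<le> W" using u \<delta> by (intro near) auto
    ultimately show ?thesis using ends by (simp add: abs_le_iff)
  qed
  \<comment> \<open>Mirror image, based at the other zero: now the midpoint of \<open>u\<close> and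
    \<open>m + \<delta>\<close> lies in the chord interval.\<close>
  have left: "\<bar>g u\<bar> \<le> 3 * W" if u: "u \<in> {m - \<delta>..m}" "u \<ge> 0" for u
  proof -
    let ?h = "(m + \<delta> - u) / 2"
    have "\<bar>g (u + 2 * ?h) - 2 * g (u + ?h) + g u\<bar> \<le> W" using u \<delta> by (intro gW) auto
    moreover have "u + 2 * ?h = m + \<delta>" by (simp add: field_simps)
    moreover have "\<bar>g (u + ?h)\<bar> \<le> W" using u \<delta> by (intro near) (auto simp: field_simps)
    ultimately show ?thesis using ends by (simp add: abs_le_iff)
  qed
  have "\<exists>k. real k \<le> \<bar>t - m\<bar> / \<delta> + 1 \<and> \<bar>g t\<bar> \<le> W * (1 + 4 * real k + (real k)\<^sup>2)"
  proof (cases "t \<ge> m")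
    case True
    \<comment> \<open>The floor counts the whole steps that can be taken back from \<open>t\<close>
      without passing \<open>m\<close>.\<close>
    define k where "k = nat \<lfloor>(t - m) / \<delta>\<rfloor>"
    have "real k = of_int \<lfloor>(t - m) / \<delta>\<rfloor>" using True \<delta> by (simp add: k_def)
    then have k1: "real k \<le> (t - m) / \<delta>" and k2: "(t - m) / \<delta> < real k + 1" by linarith+
    define s where "s = t - real k * \<delta>"
    have s: "m \<le> s" "s \<le> m + \<delta>" using k1 k2 \<delta> by (auto simp: s_def field_simps)
    have "\<bar>g (s + real k * \<delta>)\<bar> \<le> W * (1 + 4 * real k + (real k)\<^sup>2)"
    proof (rule second_difference_growth[where b = "\<lambda>k. g (s + real k * \<delta>)"])
      show "\<bar>g (s + real 0 * \<delta>)\<bar> \<le> W" using s by (simp add: near)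
      show "\<bar>g (s + real 1 * \<delta>)\<bar> \<le> 3 * W" using s by (simp add: right)
      fix j
      have "0 \<le> real j * \<delta>" using \<delta> by simp
      then show "\<bar>g (s + real (j + 2) * \<delta>) - 2 * g (s + real (j + 1) * \<delta>) + g (s + real j * \<delta>)\<bar> \<le> W"
        using gW[of "s + real j * \<delta>" \<delta>] s m \<delta> by (simp add: algebra_simps)
    qed
    then show ?thesis using k1 True by (intro exI[of _ k]) (auto simp: s_def)
  next
    case False
    \<comment> \<open>From the left the walk must reach at least \<open>m\<close>, which calls for
      the ceiling; this is the source of the \<open>+ 1\<close> in the bound on
      \<open>k\<close>.\<close>
    define k where "k = nat \<lceil>(m - t) / \<delta>\<rceil>"
    have "0 \<le> (m - t) / \<delta>" using False \<delta> by simp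
    then have "real k = of_int \<lceil>(m - t) / \<delta>\<rceil>" by (simp add: k_def)
    then have k1: "real k \<le> (m - t) / \<delta> + 1" and k2: "(m - t) / \<delta> \<le> real k" by linarith+
    define s where "s = t + real k * \<delta>"
    have s: "m \<le> s" "s \<le> m + \<delta>" using k1 k2 \<delta> by (auto simp: s_def field_simps)
    \<comment> \<open>With at least one step taken, \<open>s - \<delta>\<close> is still
      \<open>t\<close> plus a nonnegative multiple of \<open>\<delta>\<close>, so it lies in the
      half-line and \<open>left\<close> applies to it.\<close>
    have "k \<ge> 1" using False k2 \<delta> by (cases k) (auto simp: field_simps)
    then have "1 * \<delta> \<le> real k * \<delta>" using \<delta> by (intro mult_right_mono) auto
    then have s1: "s - \<delta> \<ge> 0" using t by (simp add: s_def)
    have "\<bar>g (s - real k * \<delta>)\<bar> \<le> W * (1 + 4 * real k + (real k)\<^sup>2)"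
    proof (rule second_difference_growth[where b = "\<lambda>k. g (s - real k * \<delta>)"])
      show "\<bar>g (s - real 0 * \<delta>)\<bar> \<le> W" using s by (simp add: near)
      show "\<bar>g (s - real 1 * \<delta>)\<bar> \<le> 3 * W" using s s1 by (simp add: left)
      fix j assume "j + 2 \<le> k"
      then have "real (j + 2) * \<delta> \<le> real k * \<delta>" using \<delta> by (intro mult_right_mono) auto
      then have "0 \<le> s - real (j + 2) * \<delta>" using t by (simp add: s_def)
      from gW[OF this, of \<delta>] \<delta>
      show "\<bar>g (s - real (j + 2) * \<delta>) - 2 * g (s - real (j + 1) * \<delta>) + g (s - real j * \<delta>)\<bar> \<le> W"
        by (simp add: algebra_simps)
    qed
    then show ?thesis using k1 False by (intro exI[of _ k]) (auto simp: s_def)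
  qed
  then obtain k where k: "real k \<le> \<bar>t - m\<bar> / \<delta> + 1"
    and gt: "\<bar>g t\<bar> \<le> W * (1 + 4 * real k + (real k)\<^sup>2)" by blast
  define v where "v = \<bar>t - m\<bar> / \<delta>"
  have v2: "v\<^sup>2 = ((t - m) / \<delta>)\<^sup>2" by (simp add: v_def power_divide)
  have "(real k)\<^sup>2 \<le> (v + 1)\<^sup>2" using k by (intro power_mono) (auto simp: v_def)
  then have "1 + 4 * real k + (real k)\<^sup>2 \<le> 1 + 4 * (v + 1) + (v + 1)\<^sup>2" using k unfolding v_def
    by (intro add_mono mult_left_mono) auto
  \<comment> \<open>The gap is \<open>3 * (v - 1)\<^sup>2\<close>. Absorbing the linear term here
    fixes the constants 9 and 4 and leaves only a second moment to compute.\<close>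
  also have "\<dots> \<le> 9 + 4 * v\<^sup>2"
    using zero_le_power2[of "v - 1"] by (simp add: power2_eq_square algebra_simps)
  finally have "W * (1 + 4 * real k + (real k)\<^sup>2) \<le> W * (9 + 4 * v\<^sup>2)"
    using W0 by (intro mult_left_mono)
  with gt v2 show ?thesis by (simp add: g_def c_def)
qed

section \<open>Moments of the operator\<close>

lemma rising_Suc_shift: "rising x (Suc i) \<alpha> = x * rising (x + \<alpha>) i \<alpha>"
  unfolding rising_def prod.lessThan_Suc_shift by (simp add: algebra_simps)

lemma rising_eq_pochhammer:
  assumes "\<alpha> \<noteq> 0"
  shows "rising x i \<alpha> = \<alpha> ^ i * pochhammer (x / \<alpha>) i"
proof -
  have "rising x i \<alpha> = (\<Prod>k<i. \<alpha> * (x / \<alpha> + of_nat k))"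
    unfolding rising_def using assms by (intro prod.cong) (auto simp: field_simps)
  then show ?thesis by (simp add: prod.distrib pochhammer_prod atLeast0LessThan)
qed

lemma weight_nonneg:
  assumes "\<alpha> \<ge> 0" "x \<ge> 0"
  shows "weight n \<alpha> i x \<ge> 0"
  using assms by (auto simp: weight_def rising_def intro!: mult_nonneg_nonneg prod_nonneg divide_nonneg_nonneg)

text \<open>Moments of the weights at \<open>x\<close> reduce to their total mass at \<open>x + \<alpha>\<close>.\<close>

lemma Suc_weight:
  assumes "n \<ge> 1" "\<alpha> \<ge> 0"
  shows "real (Suc i) * weight n \<alpha> (Suc i) x = real n * x * weight n \<alpha> i (x + \<alpha>)"
proof (cases "\<alpha> = 0")
  case True
  then show ?thesis by (simp add: weight_def field_simps del: of_nat_Suc)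
next
  case False
  define b where "b = 1 + real n * \<alpha>"
  have b: "b > 0" using assms by (simp add: b_def add_pos_nonneg)
  have r: "\<alpha> + 1 / real n = b / real n" using assms by (simp add: b_def field_simps)
  \<comment> \<open>Shifting \<open>x\<close> by \<open>\<alpha>\<close> releases one factor
    \<open>b\<close>, which turns the inverse power of \<open>b / real n\<close> with exponent
    \<open>Suc i\<close> into \<open>real n\<close> times the one with exponent
    \<open>i\<close>.\<close>
  have e: "- x / \<alpha> = - (x + \<alpha>) / \<alpha> + 1" using False by (simp add: field_simps)
  have p: "b powr (- x / \<alpha>) = b powr (- (x + \<alpha>) / \<alpha>) * b"
    unfolding e powr_add using b by simp
  have "weight n \<alpha> (Suc i) x
      = b powr (- (x + \<alpha>) / \<alpha>) * b * inverse ((b / real n) ^ Suc i)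
          * (x * rising (x + \<alpha>) i \<alpha> / fact (Suc i))"
    using False by (simp only: weight_def if_False r b_def[symmetric] p rising_Suc_shift)
  also have "real (Suc i) * \<dots> = real n * x * (b powr (- (x + \<alpha>) / \<alpha>) * inverse ((b / real n) ^ i)
          * (rising (x + \<alpha>) i \<alpha> / fact i))"
    using b assms by (simp add: field_simps del: of_nat_Suc)
  also have "\<dots> = real n * x * weight n \<alpha> i (x + \<alpha>)"
    using False by (simp only: weight_def if_False r b_def[symmetric])
  finally show ?thesis .
qed

text \<open>For \<open>\<alpha> = 0\<close> this is the exponential series. Otherwise the weights
  are negative binomial: with \<open>z = n * \<alpha> / (1 + n * \<alpha>)\<close> the binomial
  series of \<open>1 - z\<close> to the power \<open>- x / \<alpha>\<close> cancels the prefactor,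
  since \<open>1 - z = 1 / b\<close>.\<close>

lemma weight_sums_1:
  assumes "n \<ge> 1" "\<alpha> \<ge> 0"
  shows "(\<lambda>i. weight n \<alpha> i x) sums 1"
proof (cases "\<alpha> = 0")
  case True
  have "(\<lambda>i. exp (- (real n * x)) * (inverse (fact i) * (real n * x) ^ i))
      sums (exp (- (real n * x)) * exp (real n * x))"
    using exp_converges[of "real n * x"] by (intro sums_mult) simp
  then show ?thesis
    using True by (simp add: weight_def field_simps exp_minus_inverse flip: exp_add)
next
  case False
  define b where "b = 1 + real n * \<alpha>"
  define z where "z = real n * \<alpha> / b"
  have b: "b > 1" using assms False by (simp add: b_def)
  have r: "\<alpha> + 1 / real n = b / real n" using assms by (simp add: b_def field_simps)
  have z: "0 \<le> z" "z < 1" "1 + - z = 1 / b"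
    using b assms by (auto simp: z_def b_def field_simps)
  have "(\<lambda>i. (- x / \<alpha> gchoose i) * (- z) ^ i) sums (1 + - z) powr (- x / \<alpha>)"
    using z by (intro gen_binomial_real) auto
  from sums_mult[OF this, of "b powr (- x / \<alpha>)"]
  have "(\<lambda>i. b powr (- x / \<alpha>) * ((- x / \<alpha> gchoose i) * (- z) ^ i)) sums 1"
    using b unfolding z(3) by (simp add: powr_divide)
  moreover have "b powr (- x / \<alpha>) * ((- x / \<alpha> gchoose i) * (- z) ^ i) = weight n \<alpha> i x" for i
  proof -
    have "(- 1) ^ i * (- z) ^ i = z ^ i" by (simp flip: power_mult_distrib)
    then have "(- x / \<alpha> gchoose i) * (- z) ^ i = pochhammer (x / \<alpha>) i / fact i * z ^ i"
      by (simp add: gbinomial_pochhammer algebra_simps)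
    also have "z ^ i = \<alpha> ^ i * inverse ((b / real n) ^ i)"
      using assms b by (simp add: z_def field_simps)
    finally show ?thesis
      using False by (simp add: weight_def r b_def[symmetric] rising_eq_pochhammer)
  qed
  ultimately show ?thesis by simp
qed

text \<open>The basis 1, \<open>i\<close>, \<open>i * (i - 1)\<close> suits
  \<open>Suc_weight\<close>: each application removes one factor and moves the argument by
  \<open>\<alpha>\<close>. The first moment \<open>s2\<close> is therefore proved at every
  \<open>y\<close> and reused at \<open>x + \<alpha>\<close>.\<close>

lemma weight_sums_quadratic:
  assumes "n \<ge> 1" "\<alpha> \<ge> 0"
  shows "(\<lambda>i. weight n \<alpha> i x * (a + b * real i + c * (real i * (real i - 1))))
    sums (a + b * (real n * x) + c * ((real n)\<^sup>2 * x * (x + \<alpha>)))"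
proof -
  note s1 = weight_sums_1[OF assms] and shift = Suc_weight[OF assms]
  have s2: "(\<lambda>i. weight n \<alpha> i y * real i) sums (real n * y)" for y
  proof -
    have "(\<lambda>i. weight n \<alpha> (Suc i) y * real (Suc i)) sums (real n * y)"
      using sums_mult[OF s1[of "y + \<alpha>"], of "real n * y"] shift[of _ y] by (simp add: mult.commute)
    \<comment> \<open>The term at index 0 carries the factor 0, so undoing the index shift leaves
      the sum unchanged.\<close>
    then show ?thesis by (subst (asm) sums_Suc_iff) simp
  qed
  have s3: "(\<lambda>i. weight n \<alpha> i x * (real i * (real i - 1))) sums ((real n)\<^sup>2 * x * (x + \<alpha>))"
  proof -
    have "weight n \<alpha> (Suc i) x * (real (Suc i) * (real (Suc i) - 1))
        = real n * x * (weight n \<alpha> i (x + \<alpha>) * real i)" for i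
    proof -
      have "weight n \<alpha> (Suc i) x * (real (Suc i) * (real (Suc i) - 1))
          = (real (Suc i) * weight n \<alpha> (Suc i) x) * real i" by simp
      then show ?thesis by (simp only: shift mult.assoc)
    qed
    moreover have "(\<lambda>i. real n * x * (weight n \<alpha> i (x + \<alpha>) * real i)) sums ((real n)\<^sup>2 * x * (x + \<alpha>))"
      using sums_mult[OF s2[of "x + \<alpha>"], of "real n * x"]
      by (simp add: power2_eq_square mult_ac)
    ultimately have "(\<lambda>i. weight n \<alpha> (Suc i) x * (real (Suc i) * (real (Suc i) - 1)))
        sums ((real n)\<^sup>2 * x * (x + \<alpha>))"
      by (simp only:)
    then show ?thesis by (subst (asm) sums_Suc_iff) simp
  qed
  have "(\<lambda>i. a * weight n \<alpha> i x + b * (weight n \<alpha> i x * real i)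
        + c * (weight n \<alpha> i x * (real i * (real i - 1))))
      sums (a * 1 + b * (real n * x) + c * ((real n)\<^sup>2 * x * (x + \<alpha>)))"
    by (intro sums_add sums_mult s1 s2 s3)
  then show ?thesis by (simp add: algebra_simps)
qed

section \<open>Moments of the Erlang laws\<close>

text \<open>\<open>erlang_density i l\<close> has shape \<open>i + 1\<close>, so its mean is
  \<open>(i + 1) / l\<close>. The passage from the \<open>nn_integral\<close> is legitimate because
  the density vanishes for negative \<open>u\<close>, where \<open>u ^ k\<close> may be
  negative.\<close>

lemma has_bochner_integral_erlang_moment:
  assumes "l > 0"
  shows "has_bochner_integral lborel (\<lambda>u. erlang_density i l u * u ^ k)
    (fact (i + k) / (fact i * l ^ k))"
proof (rule has_bochner_integral_nn_integral)
  show "AE u in lborel. 0 \<le> erlang_density i l u * u ^ k"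
    using assms by (intro AE_I2) (auto simp: erlang_density_def)
qed (use assms nn_integral_erlang_ith_moment[OF assms, of i k] in auto)

lemma has_bochner_integral_erlang_quadratic:
  assumes "l > 0"
  shows "has_bochner_integral lborel (\<lambda>u. erlang_density i l u * (a + b * u + c * u\<^sup>2))
    (a + b * ((real i + 1) / l) + c * ((real i + 1) * (real i + 2) / l\<^sup>2))"
proof -
  note M = has_bochner_integral_erlang_moment[OF assms, of i]
  have "has_bochner_integral lborel
      (\<lambda>u. a * (erlang_density i l u * u ^ 0) + b * (erlang_density i l u * u ^ 1)
         + c * (erlang_density i l u * u ^ 2))
      (a * (fact (i + 0) / (fact i * l ^ 0)) + b * (fact (i + 1) / (fact i * l ^ 1))
         + c * (fact (i + 2) / (fact i * l ^ 2)))"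
    by (intro has_bochner_integral_add has_bochner_integral_mult_right M)
  moreover have "fact (i + 1) / (fact i * l ^ 1) = (real i + 1) / l"
    "fact (i + 2) / (fact i * l ^ 2) = (real i + 1) * (real i + 2) / l\<^sup>2"
    using assms by (simp_all add: field_simps)
  moreover have "(\<lambda>u. a * (erlang_density i l u * u ^ 0) + b * (erlang_density i l u * u ^ 1)
      + c * (erlang_density i l u * u ^ 2)) = (\<lambda>u. erlang_density i l u * (a + b * u + c * u\<^sup>2))"
    by (simp add: algebra_simps)
  moreover have "a * (fact (i + 0) / (fact i * l ^ 0)) = a" by simp
  ultimately show ?thesis by (simp only:)
qed

section \<open>The operator as a mixture of Erlang laws\<close>

text \<open>On the half-line \<open>real n\<close> times the kernel is exactly the Erlang density,
  which absorbs the factor in front of the series. Assuming \<open>sums\<close> excludes the default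
  value of a divergent \<open>suminf\<close>.\<close>

lemma U_eqI:
  assumes "n \<ge> 1"
    and "(\<lambda>i. weight n \<alpha> i x * (LINT u|lborel. erlang_density i (real n) u * f u)) sums s"
  shows "U n \<alpha> f x = s"
proof -
  have "(LINT u:{0..}|lborel. exp (- (real n * u)) * ((real n * u) ^ i / fact i) * f u)
      = (LINT u|lborel. erlang_density i (real n) u * f u) / real n" for i
  proof -
    have "(LINT u:{0..}|lborel. exp (- (real n * u)) * ((real n * u) ^ i / fact i) * f u)
        = (LINT u|lborel. erlang_density i (real n) u * f u / real n)"
      unfolding set_lebesgue_integral_def using assms(1)
      by (intro Bochner_Integration.integral_cong)
        (auto simp: erlang_density_def field_simps indicator_def)
    then show ?thesis by simp
  qed
  moreover have "(\<lambda>i. weight n \<alpha> i x * ((LINT u|lborel. erlang_density i (real n) u * f u) / real n))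
      sums (s / real n)"
    using sums_divide[OF assms(2), of "real n"] by simp
  ultimately show ?thesis
    unfolding U_def using assms(1) by (simp add: sums_iff)
qed

lemma weight_sums_erlang_quadratic:
  assumes "n \<ge> 1" "\<alpha> \<ge> 0"
  shows "(\<lambda>i. weight n \<alpha> i x * (LINT u|lborel. erlang_density i (real n) u * (a + b * u + c * u\<^sup>2)))
    sums (a + b * (x + 1 / real n) + c * (x * (x + \<alpha>) + 4 * x / real n + 2 / (real n)\<^sup>2))"
proof -
  have n: "real n > 0" using assms by simp
  \<comment> \<open>Re-expansion in factorial powers, using
    \<open>(i + 1) * (i + 2) = i * (i - 1) + 4 * i + 2\<close>.\<close>
  have "a + b * ((real i + 1) / real n) + c * ((real i + 1) * (real i + 2) / (real n)\<^sup>2)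
      = (a + b / real n + 2 * c / (real n)\<^sup>2) + (b / real n + 4 * c / (real n)\<^sup>2) * real i
        + c / (real n)\<^sup>2 * (real i * (real i - 1))" for i
    by (simp add: algebra_simps add_divide_distrib diff_divide_distrib)
  then have I: "(LINT u|lborel. erlang_density i (real n) u * (a + b * u + c * u\<^sup>2))
      = (a + b / real n + 2 * c / (real n)\<^sup>2) + (b / real n + 4 * c / (real n)\<^sup>2) * real i
        + c / (real n)\<^sup>2 * (real i * (real i - 1))" for i
    using has_bochner_integral_integral_eq[OF has_bochner_integral_erlang_quadratic[OF n]] by simp
  have s: "(a + b / real n + 2 * c / (real n)\<^sup>2) + (b / real n + 4 * c / (real n)\<^sup>2) * (real n * x)
        + c / (real n)\<^sup>2 * ((real n)\<^sup>2 * x * (x + \<alpha>))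
      = a + b * (x + 1 / real n) + c * (x * (x + \<alpha>) + 4 * x / real n + 2 / (real n)\<^sup>2)"
    using n by (simp add: field_simps power2_eq_square)
  show ?thesis
    unfolding I using weight_sums_quadratic[OF assms] unfolding s[symmetric] .
qed

lemma nu_eq:
  assumes "n \<ge> 1" "\<alpha> \<ge> 0"
  shows "nu n \<alpha> x = 1 / real n"
  unfolding nu_def central_moment_def
  using weight_sums_erlang_quadratic[OF assms, of x "- x" 1 0] assms
  by (intro U_eqI) simp_all

text \<open>The second moment about \<open>x\<close> ends in \<open>2 / n\<^sup>2\<close>; the
  summand in \<open>rho\<close> raises this to 3. The variance about the mean
  \<open>x + 1 / n\<close> ends in \<open>1 / n\<^sup>2\<close>, so \<open>rho\<close> exceeds it by
  \<open>2 / n\<^sup>2\<close>.\<close>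

lemma rho_eq:
  assumes "n \<ge> 1" "\<alpha> \<ge> 0"
  shows "rho n \<alpha> x = x * \<alpha> + 2 * x / real n + 3 / (real n)\<^sup>2"
proof -
  have "central_moment n \<alpha> 2 x = x * \<alpha> + 2 * x / real n + 2 / (real n)\<^sup>2"
    unfolding central_moment_def
    using weight_sums_erlang_quadratic[OF assms, of x "x\<^sup>2" "- 2 * x" 1] assms
    by (intro U_eqI) (simp_all add: power2_eq_square algebra_simps)
  then show ?thesis by (simp add: rho_def)
qed

section \<open>Comparison with the tangent at the mean\<close>

text \<open>The expectation of the affine part is \<open>f m\<close> because \<open>m\<close> is the
  mean, and that of the majorant is \<open>A\<close> plus \<open>B\<close> times the variance. The
  comparison is made in each Erlang law first and then summed against the nonnegative
  weights.\<close>

lemma U_bound: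
  fixes f :: "real \<Rightarrow> real"
  assumes n: "n \<ge> 1" and \<alpha>: "\<alpha> \<ge> 0" and x: "x \<ge> 0" and f: "f \<in> C_B"
    and m: "m = x + 1 / real n"
    and le: "\<And>t. t \<ge> 0 \<Longrightarrow> \<bar>f t - f m - c * (t - m)\<bar> \<le> A + B * (t - m)\<^sup>2"
  shows "\<bar>U n \<alpha> f x - f m\<bar> \<le> A + B * (x * \<alpha> + 2 * x / real n + 1 / (real n)\<^sup>2)"
proof -
  let ?e = "\<lambda>i. erlang_density i (real n)"
  define E where "E = (\<lambda>i h. LINT u|lborel. ?e i u * h u)"
  \<comment> \<open>The tangent and the majorant are written out in powers of \<open>u\<close> so
    that the moment formula for quadratics applies to both.\<close>
  define L where "L = (\<lambda>u. (f m - c * m) + c * u + 0 * u\<^sup>2)"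
  define Q where "Q = (\<lambda>u. (A + B * m\<^sup>2) + (- 2 * B * m) * u + B * u\<^sup>2)"
  have n0: "real n > 0" using n by simp
  obtain K where K: "\<And>u. u \<ge> 0 \<Longrightarrow> \<bar>f u\<bar> \<le> K"
    using f by (auto simp: C_B_def bounded_iff)
  have int_quad: "integrable lborel (\<lambda>u. ?e i u * (a + b * u + d * u\<^sup>2))" for i a b d
    using has_bochner_integral_erlang_quadratic[OF n0] by (rule integrable.intros)
  have int_f: "integrable lborel (\<lambda>u. ?e i u * f u)" for i
  proof (rule Bochner_Integration.integrable_bound)
    show "integrable lborel (\<lambda>u. ?e i u * K)"
      using int_quad[of i K 0 0] by simp
    \<comment> \<open>Continuity is known only on the half-line. Cutting \<open>f\<close> off there
      gives a Borel function, and the product with the density is unchanged.\<close>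
    have "(\<lambda>u. indicat_real {0..} u *\<^sub>R f u) \<in> borel_measurable borel"
      using f by (intro borel_measurable_continuous_on_indicator) (auto simp: C_B_def)
    then have "(\<lambda>u. ?e i u * (indicat_real {0..} u *\<^sub>R f u)) \<in> borel_measurable lborel"
      by measurable
    moreover have "(\<lambda>u. ?e i u * (indicat_real {0..} u *\<^sub>R f u)) = (\<lambda>u. ?e i u * f u)"
      by (auto simp: erlang_density_def indicator_def)
    ultimately show "(\<lambda>u. ?e i u * f u) \<in> borel_measurable lborel" by simp
    show "AE u in lborel. norm (?e i u * f u) \<le> norm (?e i u * K)"
    proof (intro AE_I2)
      fix u
      show "norm (?e i u * f u) \<le> norm (?e i u * K)"
      proof (cases "u \<ge> 0")
        case True
        then show ?thesis using K[of u] by (simp add: abs_mult mult_left_mono)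
      qed (simp add: erlang_density_def)
    qed
  qed
  have int_L: "integrable lborel (\<lambda>u. ?e i u * L u)" and int_Q: "integrable lborel (\<lambda>u. ?e i u * Q u)" for i
    unfolding L_def Q_def by (rule int_quad)+
  have EQ: "\<bar>E i f - E i L\<bar> \<le> E i Q" for i
  proof -
    have "E i f - E i L = (LINT u|lborel. ?e i u * f u - ?e i u * L u)"
      unfolding E_def by (rule Bochner_Integration.integral_diff[symmetric, OF int_f int_L])
    also have "\<bar>\<dots>\<bar> \<le> (LINT u|lborel. \<bar>?e i u * f u - ?e i u * L u\<bar>)"
      by (rule integral_abs_bound)
    also have "\<dots> \<le> E i Q"
      unfolding E_def
    proof (rule integral_mono)
      show "integrable lborel (\<lambda>u. \<bar>?e i u * f u - ?e i u * L u\<bar>)"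
        using int_f int_L by (intro integrable_abs Bochner_Integration.integrable_diff)
      fix u
      show "\<bar>?e i u * f u - ?e i u * L u\<bar> \<le> ?e i u * Q u"
      proof (cases "u \<ge> 0")
        case True
        have "\<bar>?e i u * f u - ?e i u * L u\<bar> = ?e i u * \<bar>f u - L u\<bar>"
          by (simp add: abs_mult flip: right_diff_distrib)
        also have "\<bar>f u - L u\<bar> = \<bar>f u - f m - c * (u - m)\<bar>"
          by (simp add: L_def algebra_simps)
        also have "?e i u * \<dots> \<le> ?e i u * (A + B * (u - m)\<^sup>2)"
          using le[OF True] by (intro mult_left_mono) auto
        also have "A + B * (u - m)\<^sup>2 = Q u"
          by (simp add: Q_def power2_eq_square algebra_simps)
        finally show ?thesis .
      qed (simp add: erlang_density_def)
    qed (rule int_Q)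
    finally show ?thesis .
  qed
  have sL: "(\<lambda>i. weight n \<alpha> i x * E i L) sums f m"
    using weight_sums_erlang_quadratic[OF n \<alpha>, of x "f m - c * m" c 0]
    by (simp add: E_def L_def flip: m)
  have "A + B * m\<^sup>2 + - 2 * B * m * m + B * (x * (x + \<alpha>) + 4 * x / real n + 2 / (real n)\<^sup>2)
      = A + B * (x * \<alpha> + 2 * x / real n + 1 / (real n)\<^sup>2)"
    using n0 by (simp add: m field_simps power2_eq_square)
  then have sQ: "(\<lambda>i. weight n \<alpha> i x * E i Q) sums (A + B * (x * \<alpha> + 2 * x / real n + 1 / (real n)\<^sup>2))"
    using weight_sums_erlang_quadratic[OF n \<alpha>, of x "A + B * m\<^sup>2" "- 2 * B * m" B]
    unfolding E_def Q_def m[symmetric] by (simp only:)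
  have dom: "\<bar>weight n \<alpha> i x * (E i f - E i L)\<bar> \<le> weight n \<alpha> i x * E i Q" for i
    using EQ[of i] weight_nonneg[OF \<alpha> x, of n i] by (simp add: abs_mult mult_left_mono)
  \<comment> \<open>The series for \<open>Q\<close> dominates the differences, so the series for
    \<open>f\<close> converges once that of \<open>L\<close> is added back.\<close>
  have sabs: "summable (\<lambda>i. \<bar>weight n \<alpha> i x * (E i f - E i L)\<bar>)"
    using dom by (intro summable_comparison_test'[OF sums_summable[OF sQ], of 0]) auto
  define R where "R = (\<Sum>i. weight n \<alpha> i x * (E i f - E i L))"
  have sR: "(\<lambda>i. weight n \<alpha> i x * (E i f - E i L)) sums R"
    unfolding R_def by (intro summable_sums summable_rabs_cancel[OF sabs])
  have "\<bar>R\<bar> \<le> (\<Sum>i. \<bar>weight n \<alpha> i x * (E i f - E i L)\<bar>)"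
    unfolding R_def by (rule summable_rabs[OF sabs])
  also have "\<dots> \<le> (\<Sum>i. weight n \<alpha> i x * E i Q)"
    by (rule suminf_le[OF dom sabs sums_summable[OF sQ]])
  finally have R: "\<bar>R\<bar> \<le> A + B * (x * \<alpha> + 2 * x / real n + 1 / (real n)\<^sup>2)"
    using sQ by (simp add: sums_iff)
  have "(\<lambda>i. weight n \<alpha> i x * E i f) sums (R + f m)"
    using sums_add[OF sR sL] by (simp add: algebra_simps)
  then have "U n \<alpha> f x = R + f m"
    unfolding E_def by (intro U_eqI[OF n])
  with R show ?thesis by simp
qed

section \<open>The moduli as upper bounds, and the final estimate\<close>

text \<open>Boundedness of \<open>f\<close> bounds the differences by \<open>2 * K\<close>, so the
  real-valued supremum is a genuine upper bound; the second modulus works likewise with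
  \<open>4 * K\<close>.\<close>

lemma omega_upper:
  assumes f: "f \<in> C_B" and "0 \<le> h" "h \<le> \<xi>" "x \<ge> 0"
  shows "\<bar>f (x + h) - f x\<bar> \<le> omega f \<xi>"
proof -
  obtain K where K: "\<And>u. u \<ge> 0 \<Longrightarrow> \<bar>f u\<bar> \<le> K"
    using f by (auto simp: C_B_def bounded_iff)
  have "bdd_above ((\<lambda>(h, x). \<bar>f (x + h) - f x\<bar>) ` ({0..\<xi>} \<times> {0..}))"
  proof (rule bdd_aboveI2)
    fix p assume p: "p \<in> {0..\<xi>} \<times> {0::real..}"
    show "(case p of (h, x) \<Rightarrow> \<bar>f (x + h) - f x\<bar>) \<le> 2 * K"
      using p K[of "snd p + fst p"] K[of "snd p"] by (auto simp: case_prod_beta)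
  qed
  from cSUP_upper[OF _ this, of "(h, x)"] assms show ?thesis
    by (simp add: omega_def)
qed

lemma omega2_upper:
  assumes f: "f \<in> C_B" and "0 \<le> h" "h \<le> \<delta>" "x \<ge> 0"
  shows "\<bar>f (x + 2 * h) - 2 * f (x + h) + f x\<bar> \<le> omega2 f \<delta>"
proof -
  obtain K where K: "\<And>u. u \<ge> 0 \<Longrightarrow> \<bar>f u\<bar> \<le> K"
    using f by (auto simp: C_B_def bounded_iff)
  have "bdd_above ((\<lambda>(h, x). \<bar>f (x + 2 * h) - 2 * f (x + h) + f x\<bar>) ` ({0..\<delta>} \<times> {0..}))"
  proof (rule bdd_aboveI2)
    fix p assume p: "p \<in> {0..\<delta>} \<times> {0::real..}"
    show "(case p of (h, x) \<Rightarrow> \<bar>f (x + 2 * h) - 2 * f (x + h) + f x\<bar>) \<le> 4 * K"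
      using p K[of "snd p + fst p"] K[of "snd p + 2 * fst p"] K[of "snd p"]
      by (auto simp: case_prod_beta)
  qed
  from cSUP_upper[OF _ this, of "(h, x)"] assms show ?thesis
    by (simp add: omega2_def)
qed

theorem theorem3p1:
  "\<exists>M>0. \<forall>f\<in>C_B. \<forall>n\<ge>1. \<forall>\<alpha>\<in>{0..1 / real n}. \<forall>x\<ge>0.
     \<bar>U n \<alpha> f x - f x\<bar> \<le> M * omega2 f (sqrt (rho n \<alpha> x)) + omega f (nu n \<alpha> x)"
proof (intro exI[of _ 13] conjI ballI allI impI)
  fix f n \<alpha> and x :: real
  assume f: "f \<in> C_B" and n: "1 \<le> n" and "\<alpha> \<in> {0..1 / real n}" and x: "0 \<le> x"
  then have \<alpha>: "0 \<le> \<alpha>" by simp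
  define m where "m = x + 1 / real n"
  define r where "r = rho n \<alpha> x"
  define W where "W = omega2 f (sqrt r)"
  \<comment> \<open>The left side of \<open>V\<close> is the variance about \<open>m\<close>. The
    term \<open>3 / n\<^sup>2\<close> in \<open>rho\<close> keeps \<open>r\<close> positive even at
    \<open>x = 0\<close>, so \<open>sqrt r\<close> can serve as a step length.\<close>
  have V: "x * \<alpha> + 2 * x / real n + 1 / (real n)\<^sup>2 \<le> r" and r: "r > 0"
    using n \<alpha> x by (auto simp: r_def rho_eq divide_right_mono intro!: add_nonneg_pos)
  have W: "\<bar>f (s + 2 * h) - 2 * f (s + h) + f s\<bar> \<le> W" if "s \<ge> 0" "0 \<le> h" "h \<le> sqrt r" for s h
    unfolding W_def using f that by (intro omega2_upper)
  have W0: "0 \<le> W" using W[of 0 0] r by simp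
  define c where "c = (f (m + sqrt r) - f m) / sqrt r"
  have "\<bar>f t - f m - c * (t - m)\<bar> \<le> 9 * W + 4 * W / r * (t - m)\<^sup>2" if "t \<ge> 0" for t
  proof -
    have "\<bar>f t - f m - c * (t - m)\<bar> \<le> W * (9 + 4 * ((t - m) / sqrt r)\<^sup>2)"
      unfolding c_def using r x f that W
      by (intro second_difference_tangent) (auto simp: m_def C_B_def)
    also have "\<dots> = 9 * W + 4 * W / r * (t - m)\<^sup>2"
      using r by (simp add: power_divide algebra_simps)
    finally show ?thesis .
  qed
  then have "\<bar>U n \<alpha> f x - f m\<bar> \<le> 9 * W + 4 * W / r * (x * \<alpha> + 2 * x / real n + 1 / (real n)\<^sup>2)"
    by (intro U_bound[OF n \<alpha> x f m_def])
  \<comment> \<open>The step length was chosen so that variance over \<open>r\<close> is at most 1: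
    the quadratic term costs at most \<open>4 * W\<close>, and 9 + 4 gives the constant 13.\<close>
  also have "\<dots> \<le> 9 * W + 4 * W / r * r"
    using V W0 r by (intro add_left_mono mult_left_mono) auto
  also have "\<dots> = 13 * W" using r by simp
  finally have "\<bar>U n \<alpha> f x - f m\<bar> \<le> 13 * W" .
  moreover have "\<bar>f m - f x\<bar> \<le> omega f (nu n \<alpha> x)"
    unfolding m_def nu_eq[OF n \<alpha>] using f x by (intro omega_upper) auto
  ultimately show "\<bar>U n \<alpha> f x - f x\<bar> \<le> 13 * omega2 f (sqrt (rho n \<alpha> x)) + omega f (nu n \<alpha> x)"
    by (simp add: W_def r_def)
qed simp

end
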